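(* Let $r\ge 1$, $n=r+1$, and let $\tilde\alpha$ be the highest root of $\mathfrak{sl}_n=\mathfrak{sl}_n(\mathbb C)$. If $\mu\in P(\mathfrak{sl}_n)$, then $$m(\tilde\alpha,\mu)=\begin{cases} r & \text{if }\mu=0,\\ 1 & \text{if }\mu\in\Phi,\\ 0 & \text{otherwise.}\end{cases}$$
   Context: Setting: $\mathfrak g=\mathfrak{sl}_n(\mathbb C)$, with Cartan subalgebra $\mathfrak h$ of diagonal trace-zero matrices and Borel subalgebra of upper triangular trace-zero matrices. For $1\le i\le n$ let $\varepsilon_i\in\mathfrak h^*$ send a diagonal matrix to its $i$-th entry (so $\varepsilon_1+\cdots+\varepsilon_n=0$ on $\mathfrak h$). The Weyl group is $W=S_n$, acting on $\mathfrak h^*$ by $\sigma(\varepsilon_i)=\varepsilon_{\sigma(i)}$. The set of roots is $\Phi=\{\varepsilon_i-\varepsilon_j: i\ne j\}$, the positive roots are $\Phi^+=\{\varepsilon_i-\varepsilon_j: 1\le i<j\le n\}$, the highest root is $\tilde\alpha=\varepsilon_1-\varepsilon_n$, and $\rho=\frac12\sum_{\alpha\in\Phi^+}\alpha$. The fundamental weights are $\varpi_i=\varepsilon_1+\cdots+\varepsilon_i$ for $1\le i\le r$, and the set of integral weights is $P(\mathfrak{sl}_n)=\{a_1\varpi_1+\cdots+a_r\varpi_r: a_i\in\mathbb Z\}$. Multiplicity: $L(\lambda)$ is the finite-dimensional irreducible representation of $\mathfrak g$ with dominant integral highest weight $\lambda$, and $m(\lambda,\mu)$ is the multiplicity (dimension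 of the weight space) of the weight $\mu$ in $L(\lambda)$. By Kostant's weight multiplicity formula, $m(\lambda,\mu)=\sum_{\sigma\in W}\epsilon(\sigma)\,\wp(\sigma(\lambda+\rho)-(\mu+\rho))$, where $\epsilon(\sigma)=(-1)^{\ell(\sigma)}$ is the sign of $\sigma$ and $\wp(\xi)$ is the number of ways to write $\xi\in\mathfrak h^*$ as a non-negative integral sum of positive roots. *)

theory Defs
  imports "Jordan_Normal_Form.Matrix" "HOL-Library.Function_Algebras" Complex_Main
begin

definition sl :: "nat \<Rightarrow> complex mat set" where
  "sl n = {A \<in> carrier_mat n n. (\<Sum>i<n. A $$ (i, i)) = 0}"

definition lie_bracket :: "complex mat \<Rightarrow> complex mat \<Rightarrow> complex mat" where
  "lie_bracket A B = A * B - B * A"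

definition cartan :: "nat \<Rightarrow> complex mat set" where
  "cartan n = {A \<in> sl n. diagonal_mat A}"

definition borel :: "nat \<Rightarrow> complex mat set" where
  "borel n = {A \<in> sl n. upper_triangular A}"

text \<open>The nilradical of the Borel subalgebra: the strictly upper triangular matrices,
  i.e. the sum of the positive root spaces.\<close>

definition nilradical :: "nat \<Rightarrow> complex mat set" where
  "nilradical n = {A \<in> borel n. \<forall>i<n. A $$ (i, i) = 0}"

text \<open>A functional on the Cartan subalgebra is represented by the function on all matrices that
  extends it by \<open>0\<close> off \<^term>\<open>cartan n\<close>. Sums, differences, scalar multiples and the zero
  functional are then the pointwise ones, and equality of functionals is equality of functions; in
  particular \<open>\<epsilon>\<^sub>1 + \<dots> + \<epsilon>\<^sub>n = 0\<close>. Matrix indices start at \<open>0\<close>, whereas the index of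
  \<open>\<epsilon>\<^sub>i\<close> starts at \<open>1\<close>.\<close>

type_synonym weight = "complex mat \<Rightarrow> complex"

definition eps :: "nat \<Rightarrow> nat \<Rightarrow> weight" where
  "eps n i = (\<lambda>H. if H \<in> cartan n then H $$ (i - 1, i - 1) else 0)"

definition sl_roots :: "nat \<Rightarrow> weight set" where
  "sl_roots n = {eps n i - eps n j | i j. i \<in> {1..n} \<and> j \<in> {1..n} \<and> i \<noteq> j}"

definition highest_root :: "nat \<Rightarrow> weight" where
  "highest_root n = eps n 1 - eps n n"

definition fundamental_weight :: "nat \<Rightarrow> nat \<Rightarrow> weight" where
  "fundamental_weight n i = (\<Sum>k = 1..i. eps n k)"

definition integral_weights :: "nat \<Rightarrow> weight set" where
  "integral_weights n =
     {(\<lambda>H. \<Sum>i = 1..n - 1. of_int (a i) * fundamental_weight n i H) | a :: nat \<Rightarrow> int. True}"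

text \<open>The representation space is a subspace \<open>V\<close> of an ambient complex vector space, and
  \<open>act X v\<close> is the action of \<open>X\<close> on \<open>v\<close>; its values for \<open>X\<close> outside \<^term>\<open>sl n\<close> or \<open>v\<close>
  outside \<open>V\<close> are irrelevant.\<close>

locale sl_rep = vector_space scale
  for scale :: "complex \<Rightarrow> 'v::ab_group_add \<Rightarrow> 'v" (infixr "*s" 75) +
  fixes n :: nat
    and V :: "'v set"
    and act :: "complex mat \<Rightarrow> 'v \<Rightarrow> 'v"
  assumes subspace_V: "subspace V"
    and act_closed: "\<lbrakk>X \<in> sl n; v \<in> V\<rbrakk> \<Longrightarrow> act X v \<in> V"
    and act_add_right: "\<lbrakk>X \<in> sl n; v \<in> V; w \<in> V\<rbrakk> \<Longrightarrow> act X (v + w) = act X v + act X w"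
    and act_scale_right: "\<lbrakk>X \<in> sl n; v \<in> V\<rbrakk> \<Longrightarrow> act X (c *s v) = c *s act X v"
    and act_add_left: "\<lbrakk>X \<in> sl n; Y \<in> sl n; v \<in> V\<rbrakk> \<Longrightarrow> act (X + Y) v = act X v + act Y v"
    and act_scale_left: "\<lbrakk>X \<in> sl n; v \<in> V\<rbrakk> \<Longrightarrow> act (c \<cdot>\<^sub>m X) v = c *s act X v"
    and act_bracket: "\<lbrakk>X \<in> sl n; Y \<in> sl n; v \<in> V\<rbrakk> \<Longrightarrow>
          act (lie_bracket X Y) v = act X (act Y v) - act Y (act X v)"
begin

definition finite_dimensional :: bool where
  "finite_dimensional \<longleftrightarrow> (\<exists>B. finite B \<and> V = span B)"

definition subrep :: "'v set \<Rightarrow> bool" where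
  "subrep W \<longleftrightarrow> subspace W \<and> W \<subseteq> V \<and> (\<forall>X\<in>sl n. \<forall>w\<in>W. act X w \<in> W)"

definition irreducible_rep :: bool where
  "irreducible_rep \<longleftrightarrow> V \<noteq> {0} \<and> (\<forall>W. subrep W \<longrightarrow> W = {0} \<or> W = V)"

definition weight_space :: "weight \<Rightarrow> 'v set" where
  "weight_space \<mu> = {v \<in> V. \<forall>H\<in>cartan n. act H v = \<mu> H *s v}"

definition has_highest_weight :: "weight \<Rightarrow> bool" where
  "has_highest_weight lam \<longleftrightarrow>
     (\<exists>v\<in>weight_space lam. v \<noteq> 0 \<and> (\<forall>X\<in>nilradical n. act X v = 0))"

end

text \<open>\<open>L(\<lambda>)\<close> is determined only up to isomorphism. Every finite-dimensional complex vector space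
  is isomorphic to a subspace of the space of all functions \<^typ>\<open>nat \<Rightarrow> complex\<close>, so a
  representative can be chosen there.\<close>

type_synonym cfun = "nat \<Rightarrow> complex"

definition cscale :: "complex \<Rightarrow> cfun \<Rightarrow> cfun" where
  "cscale c f = (\<lambda>i. c * f i)"

lemma vector_space_cscale: "vector_space cscale"
  by unfold_locales (auto simp: cscale_def fun_eq_iff algebra_simps)

definition is_L :: "nat \<Rightarrow> weight \<Rightarrow> cfun set \<times> (complex mat \<Rightarrow> cfun \<Rightarrow> cfun) \<Rightarrow> bool" where
  "is_L n lam = (\<lambda>(V, act).
     sl_rep cscale n V act \<and>
     sl_rep.finite_dimensional cscale V \<and>
     sl_rep.irreducible_rep cscale n V act \<and>
     sl_rep.has_highest_weight cscale n V act lam)"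

definition irrep_L :: "nat \<Rightarrow> weight \<Rightarrow> cfun set \<times> (complex mat \<Rightarrow> cfun \<Rightarrow> cfun)" where
  "irrep_L n lam = (SOME M. is_L n lam M)"

definition weight_mult :: "nat \<Rightarrow> weight \<Rightarrow> weight \<Rightarrow> nat" where
  "weight_mult n lam \<mu> = (case irrep_L n lam of (V, act) \<Rightarrow>
     vector_space.dim cscale (sl_rep.weight_space cscale n V act \<mu>))"

end

theory Submission
  imports Defs
begin

text \<open>The irreducible representation whose highest weight is the highest root is the adjoint
  representation, and its weight spaces can be read off from the matrix entries: a diagonal matrix
  \<open>H\<close> multiplies the entry \<open>(i, j)\<close> of \<open>A\<close> by \<open>H\<^sub>i\<^sub>i - H\<^sub>j\<^sub>j\<close>. Hence the weight \<open>0\<close> occurs on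
  the diagonal trace-zero matrices, a space of dimension \<open>n - 1 = r\<close>, each root occurs on the line
  spanned by one matrix unit, and nothing else occurs.

  Since \<^const>\<open>irrep_L\<close> is an arbitrary choice, two things support this computation. A model
  exists: the adjoint representation, with a matrix stored as the vector of its entries, is
  irreducible because \<open>sl n\<close> is simple (\<open>is_L_ad\<close>). And all models have the same multiplicities
  (\<open>dim_weight_space_eq\<close>). For the latter, let \<open>v\<close> and \<open>w\<close> be highest weight vectors of two
  irreducible representations with the same highest weight. The subrepresentation of the direct
  sum generated by \<open>(v, w)\<close> is obtained by applying strictly lower triangular matrices only, so up to
  multiples of \<open>(v, w)\<close> both components of its elements consist of vectors of lower height. It
  therefore contains neither \<open>(v, 0)\<close> nor \<open>(0, w)\<close>, and irreducibility turns it into the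
  graph of an isomorphism.\<close>

section \<open>Brackets of trace-zero matrices\<close>

lemma sl_carrier: "A \<in> sl n \<Longrightarrow> A \<in> carrier_mat n n"
  by (simp add: sl_def)

lemma cartan_sl: "H \<in> cartan n \<Longrightarrow> H \<in> sl n"
  by (simp add: cartan_def)

lemma nilradical_sl: "X \<in> nilradical n \<Longrightarrow> X \<in> sl n"
  by (simp add: nilradical_def borel_def)

lemma lie_bracket_dim [simp]:
  "dim_row (lie_bracket A B) = dim_row B" "dim_col (lie_bracket A B) = dim_col A"
  by (simp_all add: lie_bracket_def)

lemma lie_bracket_carrier:
  assumes "A \<in> carrier_mat n n" "B \<in> carrier_mat n n"
  shows "lie_bracket A B \<in> carrier_mat n n"
  using assms by (auto simp: lie_bracket_def)

lemma lie_bracket_index: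
  assumes "A \<in> carrier_mat n n" "B \<in> carrier_mat n n" "i < n" "j < n"
  shows "lie_bracket A B $$ (i, j) =
    (\<Sum>k<n. A $$ (i, k) * B $$ (k, j)) - (\<Sum>k<n. B $$ (i, k) * A $$ (k, j))"
  using assms by (auto simp: lie_bracket_def scalar_prod_def atLeast0LessThan)

lemma sl_add: "A \<in> sl n \<Longrightarrow> B \<in> sl n \<Longrightarrow> A + B \<in> sl n"
  by (auto simp: sl_def sum.distrib)

lemma sl_smult: "A \<in> sl n \<Longrightarrow> c \<cdot>\<^sub>m A \<in> sl n"
  by (auto simp: sl_def simp flip: sum_distrib_left)

lemma sl_lie_bracket:
  assumes "A \<in> sl n" "B \<in> sl n"
  shows "lie_bracket A B \<in> sl n"
proof -
  note c = assms[THEN sl_carrier]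
  have "(\<Sum>i<n. lie_bracket A B $$ (i, i)) =
      (\<Sum>i<n. \<Sum>k<n. A $$ (i, k) * B $$ (k, i)) - (\<Sum>i<n. \<Sum>k<n. B $$ (i, k) * A $$ (k, i))"
    by (simp add: lie_bracket_index[OF c] sum_subtractf)
  also have "(\<Sum>i<n. \<Sum>k<n. B $$ (i, k) * A $$ (k, i)) = (\<Sum>i<n. \<Sum>k<n. A $$ (i, k) * B $$ (k, i))"
    by (subst sum.swap) (simp add: mult.commute)
  finally show ?thesis
    using lie_bracket_carrier[OF c] by (simp add: sl_def)
qed

lemma lie_bracket_add_right:
  assumes "X \<in> carrier_mat n n" "A \<in> carrier_mat n n" "B \<in> carrier_mat n n"
  shows "lie_bracket X (A + B) = lie_bracket X A + lie_bracket X B"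
  by (rule eq_matI)
    (use assms in
      \<open>auto simp: lie_bracket_index[of _ n] algebra_simps sum.distrib\<close>)

lemma lie_bracket_add_left:
  assumes "X \<in> carrier_mat n n" "A \<in> carrier_mat n n" "B \<in> carrier_mat n n"
  shows "lie_bracket (A + B) X = lie_bracket A X + lie_bracket B X"
  by (rule eq_matI)
    (use assms in
      \<open>auto simp: lie_bracket_index[of _ n] algebra_simps sum.distrib\<close>)

lemma lie_bracket_smult_right:
  assumes "X \<in> carrier_mat n n" "A \<in> carrier_mat n n"
  shows "lie_bracket X (c \<cdot>\<^sub>m A) = c \<cdot>\<^sub>m lie_bracket X A"
  by (rule eq_matI)
    (use assms in
      \<open>auto simp: lie_bracket_index[of _ n] algebra_simps sum_distrib_left\<close>)

lemma lie_bracket_smult_left: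
  assumes "X \<in> carrier_mat n n" "A \<in> carrier_mat n n"
  shows "lie_bracket (c \<cdot>\<^sub>m X) A = c \<cdot>\<^sub>m lie_bracket X A"
  by (rule eq_matI)
    (use assms in
      \<open>auto simp: lie_bracket_index[of _ n] algebra_simps sum_distrib_left\<close>)

lemma jacobi:
  assumes "X \<in> carrier_mat n n" "Y \<in> carrier_mat n n" "A \<in> carrier_mat n n"
  shows "lie_bracket (lie_bracket X Y) A =
    lie_bracket X (lie_bracket Y A) - lie_bracket Y (lie_bracket X A)"
proof -
  note c = assms mult_carrier_mat[of _ n n _ n]
  have "lie_bracket (lie_bracket X Y) A
      = (X * (Y * A) - Y * (X * A)) - (A * (X * Y) - A * (Y * X))"
    using c by (simp add: lie_bracket_def minus_mult_distrib_mat[of _ n n _ _ n]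
        mult_minus_distrib_mat[of _ n n _ n] assoc_mult_mat[of _ n n _ n _ n])
  also have "\<dots> = ((X * (Y * A) - X * (A * Y)) - (Y * (A * X) - A * (Y * X)))
      - ((Y * (X * A) - Y * (A * X)) - (X * (A * Y) - A * (X * Y)))"
    by (rule eq_matI) (use c in auto)
  also have "\<dots> = lie_bracket X (lie_bracket Y A) - lie_bracket Y (lie_bracket X A)"
    using c by (simp add: lie_bracket_def minus_mult_distrib_mat[of _ n n _ _ n]
        mult_minus_distrib_mat[of _ n n _ n] assoc_mult_mat[of _ n n _ n _ n])
  finally show ?thesis .
qed

lemma cartan_index: "H \<in> cartan n \<Longrightarrow> i < n \<Longrightarrow> k < n \<Longrightarrow> i \<noteq> k \<Longrightarrow> H $$ (i, k) = 0"
  by (auto simp: cartan_def diagonal_mat_def sl_def)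

lemma lie_bracket_cartan_index:
  assumes H: "H \<in> cartan n" and A: "A \<in> carrier_mat n n" and ij: "i < n" "j < n"
  shows "lie_bracket H A $$ (i, j) = (H $$ (i, i) - H $$ (j, j)) * A $$ (i, j)"
proof -
  have "(\<Sum>k<n. H $$ (i, k) * A $$ (k, j)) = (\<Sum>k<n. if k = i then H $$ (i, i) * A $$ (i, j) else 0)"
    using H ij by (intro sum.cong) (auto simp: cartan_index)
  moreover have "(\<Sum>k<n. A $$ (i, k) * H $$ (k, j)) = (\<Sum>k<n. if k = j then A $$ (i, j) * H $$ (j, j) else 0)"
    using H ij by (intro sum.cong) (auto simp: cartan_index)
  ultimately show ?thesis
    using ij lie_bracket_index[OF sl_carrier[OF cartan_sl[OF H]] A ij]
    by (simp add: algebra_simps)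
qed

definition strictly_lower :: "nat \<Rightarrow> complex mat set" where
  "strictly_lower n = {A \<in> carrier_mat n n. \<forall>i<n. \<forall>j<n. i \<le> j \<longrightarrow> A $$ (i, j) = 0}"

definition subdiagonal :: "nat \<Rightarrow> nat \<Rightarrow> complex mat set" where
  "subdiagonal n d = {A \<in> carrier_mat n n. \<forall>i<n. \<forall>j<n. i \<noteq> j + d \<longrightarrow> A $$ (i, j) = 0}"

lemma strictly_lower_sl: "A \<in> strictly_lower n \<Longrightarrow> A \<in> sl n"
  by (auto simp: strictly_lower_def sl_def)

lemma subdiagonal_strictly_lower: "1 \<le> d \<Longrightarrow> A \<in> subdiagonal n d \<Longrightarrow> A \<in> strictly_lower n"
  by (auto simp: strictly_lower_def subdiagonal_def)

text \<open>A strictly lower triangular matrix is the sum of its subdiagonals, which are eigenvectors of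
  \<open>ad (rho_check n)\<close>. This induction reduces statements about the lower triangular part to
  these homogeneous pieces.\<close>

lemma strictly_lower_induct [consumes 1, case_names zero add subdiagonal]:
  assumes X: "X \<in> strictly_lower n"
    and zero: "P (0\<^sub>m n n)"
    and add: "\<And>X Y. X \<in> strictly_lower n \<Longrightarrow> Y \<in> strictly_lower n \<Longrightarrow> P X \<Longrightarrow> P Y \<Longrightarrow> P (X + Y)"
    and sub: "\<And>d D. 1 \<le> d \<Longrightarrow> D \<in> subdiagonal n d \<Longrightarrow> P D"
  shows "P X"
proof -
  have "P X" if "X \<in> strictly_lower n" "\<forall>i<n. \<forall>j<n. j + m < i \<longrightarrow> X $$ (i, j) = 0" for X m
    using that
  proof (induction m arbitrary: X)
    case 0
    then have "X = 0\<^sub>m n n"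
      by (intro eq_matI) (auto simp: strictly_lower_def not_le[symmetric])
    then show ?case using zero by simp
  next
    case (Suc m)
    define Y where "Y = mat n n (\<lambda>(i, j). if i = j + Suc m then 0 else X $$ (i, j))"
    define D where "D = mat n n (\<lambda>(i, j). if i = j + Suc m then X $$ (i, j) else 0)"
    have X: "X = Y + D"
      using Suc.prems by (intro eq_matI) (auto simp: Y_def D_def strictly_lower_def)
    have D: "D \<in> subdiagonal n (Suc m)" by (auto simp: D_def subdiagonal_def)
    have Y: "Y \<in> strictly_lower n" using Suc.prems by (auto simp: Y_def strictly_lower_def)
    have "P Y"
      using Suc.prems by (intro Suc.IH[OF Y]) (auto simp: Y_def)
    with Y D show ?case
      unfolding X by (intro add sub[of "Suc m" D] subdiagonal_strictly_lower[of "Suc m" D]) auto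
  qed
  from this[of X n] X show ?thesis by auto
qed

lemma sl_triangular_decomposition:
  assumes "X \<in> sl n"
  obtains L H N where "X = L + (H + N)" "L \<in> strictly_lower n" "H \<in> cartan n" "N \<in> nilradical n"
proof
  let ?L = "mat n n (\<lambda>(i, j). if j < i then X $$ (i, j) else 0)"
  let ?H = "mat n n (\<lambda>(i, j). if i = j then X $$ (i, j) else 0)"
  let ?N = "mat n n (\<lambda>(i, j). if i < j then X $$ (i, j) else 0)"
  show "X = ?L + (?H + ?N)" using assms by (intro eq_matI) (auto simp: sl_def)
  show "?L \<in> strictly_lower n" by (auto simp: strictly_lower_def)
  show "?H \<in> cartan n" using assms by (auto simp: cartan_def sl_def diagonal_mat_def)
  show "?N \<in> nilradical n" by (auto simp: nilradical_def borel_def sl_def)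
qed

text \<open>Half the sum of the positive coroots. Its eigenvalue on a weight vector is the height of the weight;
  as its diagonal entries fall by one from each row to the next, a matrix supported on the
  \<open>d\<close>-th subdiagonal lowers the height by \<open>d\<close>.\<close>

definition rho_check :: "nat \<Rightarrow> complex mat" where
  "rho_check n = mat n n (\<lambda>(i, j). if i = j then (of_nat n - 1) / 2 - of_nat i else 0)"

lemma rho_check_cartan: "rho_check n \<in> cartan n"
proof -
  have "(\<Sum>i<n. of_nat i :: complex) = of_nat n * (of_nat n - 1) / 2"
    by (induction n) (auto simp: field_simps)
  then show ?thesis
    by (auto simp: rho_check_def cartan_def sl_def diagonal_mat_def sum_subtractf)
qed

lemma lie_bracket_rho_check:
  assumes "A \<in> subdiagonal n d"
  shows "lie_bracket (rho_check n) A = (- of_nat d) \<cdot>\<^sub>m A"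
proof (rule eq_matI)
  have A: "A \<in> carrier_mat n n" using assms by (simp add: subdiagonal_def)
  fix i j assume "i < dim_row (- of_nat d \<cdot>\<^sub>m A)" "j < dim_col (- of_nat d \<cdot>\<^sub>m A)"
  then have ij: "i < n" "j < n" using A by auto
  show "lie_bracket (rho_check n) A $$ (i, j) = (- of_nat d \<cdot>\<^sub>m A) $$ (i, j)"
    unfolding lie_bracket_cartan_index[OF rho_check_cartan A ij]
    using assms A ij by (cases "i = j + d") (auto simp: subdiagonal_def rho_check_def)
qed (use assms in \<open>auto simp: subdiagonal_def rho_check_def\<close>)

section \<open>Representations graded by height\<close>

context sl_rep
begin

lemma V_add: "x \<in> V \<Longrightarrow> y \<in> V \<Longrightarrow> x + y \<in> V"
  by (rule subspace_add[OF subspace_V])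

lemma V_scale: "x \<in> V \<Longrightarrow> c *s x \<in> V"
  by (rule subspace_scale[OF subspace_V])

lemma V_diff: "x \<in> V \<Longrightarrow> y \<in> V \<Longrightarrow> x - y \<in> V"
  by (rule subspace_diff[OF subspace_V])

lemma V_zero: "0 \<in> V"
  by (rule subspace_0[OF subspace_V])

lemma act_zero_right: "X \<in> sl n \<Longrightarrow> act X 0 = 0"
  using act_scale_right[of X 0 0] V_zero by simp

lemma act_zero_left: "x \<in> V \<Longrightarrow> act (0\<^sub>m n n) x = 0"
  using act_scale_left[of "0\<^sub>m n n" x 0]
  by (simp add: sl_def)

text \<open>Heights are counted downwards from \<open>a\<close>, the eigenvalue of \<open>rho_check n\<close> on the highest
  weight vector.\<close>

definition height_space :: "complex \<Rightarrow> nat \<Rightarrow> 'v set" where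
  "height_space a k = {x \<in> V. act (rho_check n) x = (a - of_nat k) *s x}"

definition below :: "complex \<Rightarrow> nat \<Rightarrow> 'v set" where
  "below a m = span (\<Union>k\<in>{m..}. height_space a k)"

lemma below_subset_V: "below a m \<subseteq> V"
  unfolding below_def by (rule span_minimal[OF _ subspace_V]) (auto simp: height_space_def)

lemma below_zero: "0 \<in> below a m"
  by (simp add: below_def span_zero)

lemma below_add: "x \<in> below a m \<Longrightarrow> y \<in> below a m \<Longrightarrow> x + y \<in> below a m"
  by (simp add: below_def span_add)

lemma below_scale: "x \<in> below a m \<Longrightarrow> c *s x \<in> below a m"
  by (simp add: below_def span_scale)

lemma height_space_below: "x \<in> height_space a k \<Longrightarrow> m \<le> k \<Longrightarrow> x \<in> below a m"
  unfolding below_def by (rule span_base) auto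

lemma below_Suc: "below a (Suc m) \<subseteq> below a m"
  unfolding below_def by (rule span_mono) force

lemma subdiagonal_height_space:
  assumes D: "D \<in> subdiagonal n d" "1 \<le> d" and x: "x \<in> height_space a k"
  shows "act D x \<in> height_space a (k + d)"
proof -
  have Dsl: "D \<in> sl n" by (rule strictly_lower_sl[OF subdiagonal_strictly_lower[OF D(2,1)]])
  have R: "rho_check n \<in> sl n" by (rule cartan_sl[OF rho_check_cartan])
  have xV: "x \<in> V" and ex: "act (rho_check n) x = (a - of_nat k) *s x"
    using x by (auto simp: height_space_def)
  have "act (rho_check n) (act D x) = act D (act (rho_check n) x) + act (lie_bracket (rho_check n) D) x"
    using act_bracket[OF R Dsl xV] by simp
  also have "\<dots> = (a - of_nat (k + d)) *s act D x"
    unfolding lie_bracket_rho_check[OF D(1)] ex act_scale_right[OF Dsl xV] act_scale_left[OF Dsl xV]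
    by (simp add: scale_left_diff_distrib scale_left_distrib)
  finally show ?thesis
    using act_closed[OF Dsl xV] by (simp add: height_space_def)
qed

text \<open>Each subdiagonal of \<open>F\<close> lowers the height by at least one, and \<open>F\<close> is the sum of its
  subdiagonals.\<close>

lemma strictly_lower_below:
  assumes F: "F \<in> strictly_lower n" and x: "x \<in> below a m"
  shows "act F x \<in> below a (Suc m)"
proof -
  have "\<forall>x\<in>below a m. act F x \<in> below a (Suc m)"
    using F
  proof (induction F rule: strictly_lower_induct)
    case zero
    then show ?case using below_subset_V[of a m] by (auto simp: act_zero_left below_def span_zero)
  next
    case (add X Y)
    show ?case
    proof
      fix x assume x: "x \<in> below a m"
      then have "act (X + Y) x = act X x + act Y x"
        using add below_subset_V[of a m] by (intro act_add_left strictly_lower_sl) auto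
      then show "act (X + Y) x \<in> below a (Suc m)"
        using add x by (auto simp: below_def intro: span_add)
    qed
  next
    case (subdiagonal d D)
    have Dsl: "D \<in> sl n" by (rule strictly_lower_sl[OF subdiagonal_strictly_lower[OF subdiagonal]])
    show ?case
    proof
      fix x assume "x \<in> below a m"
      then have "x \<in> V \<and> act D x \<in> below a (Suc m)"
        unfolding below_def
      proof (induction rule: span_induct_alt)
        case base
        show ?case by (simp add: V_zero act_zero_right[OF Dsl] span_zero)
      next
        case (step c x y)
        then obtain k where k: "m \<le> k" "x \<in> height_space a k" by auto
        then have "act D x \<in> height_space a (k + d)"
          using subdiagonal_height_space subdiagonal by auto
        moreover have "Suc m \<le> k + d" using k subdiagonal by simp
        ultimately have "act D x \<in> span (\<Union>k\<in>{Suc m..}. height_space a k)"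
          by (intro span_base) auto
        moreover have xV: "x \<in> V" using k by (simp add: height_space_def)
        ultimately show ?case
          using step Dsl by (auto simp: act_add_right act_scale_right V_scale
              intro!: V_add span_add intro: span_scale)
      qed
      then show "act D x \<in> below a (Suc m)" ..
    qed
  qed
  then show ?thesis using x by blast
qed

text \<open>The operator \<open>\<Prod>j=1..N. (rho_check n - (a - j))\<close>, which kills the heights \<open>a - 1, \<dots>, a - N\<close>
  and acts on the height \<open>a\<close> by the nonzero scalar \<open>N!\<close>.\<close>

primrec height_annihilator :: "complex \<Rightarrow> nat \<Rightarrow> 'v \<Rightarrow> 'v" where
  "height_annihilator a 0 x = x"
| "height_annihilator a (Suc N) x = act (rho_check n) (height_annihilator a N x)
     - (a - of_nat (Suc N)) *s height_annihilator a N x"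

lemma height_annihilator_closed: "x \<in> V \<Longrightarrow> height_annihilator a N x \<in> V"
  by (induction N) (auto intro!: V_diff V_scale act_closed cartan_sl[OF rho_check_cartan])

lemma height_annihilator_linear:
  "x \<in> V \<Longrightarrow> y \<in> V \<Longrightarrow>
    height_annihilator a N (c *s x + y) = c *s height_annihilator a N x + height_annihilator a N y"
  by (induction N)
    (auto simp: act_add_right act_scale_right V_scale height_annihilator_closed
      cartan_sl[OF rho_check_cartan] algebra_simps)

lemma height_annihilator_eigenvector:
  assumes "x \<in> V" "act (rho_check n) x = b *s x"
  shows "height_annihilator a N x = (\<Prod>j=1..N. b - a + of_nat j) *s x"
  using assms
  by (induction N)
    (simp_all add: act_scale_right cartan_sl[OF rho_check_cartan] scale_left_diff_distrib
      scale_left_distrib ring_distribs mult.commute)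

text \<open>Eigenvectors for distinct eigenvalues are independent. Concretely, any element of
  \<open>below a 1\<close> involves finitely many heights and is therefore killed by a long enough
  \<open>height_annihilator\<close>, but \<open>v\<close> is not.\<close>

lemma not_below:
  assumes v: "v \<in> V" "v \<noteq> 0" "act (rho_check n) v = a *s v"
  shows "v \<notin> below a 1"
proof
  assume "v \<in> below a 1"
  then have "v \<in> V \<and> (\<exists>N. \<forall>M\<ge>N. height_annihilator a M v = 0)"
    unfolding below_def
  proof (induction rule: span_induct_alt)
    case base
    have "height_annihilator a M 0 = 0" for M
      using height_annihilator_eigenvector[of 0 0 a M] V_zero act_zero_right[OF cartan_sl[OF rho_check_cartan]]
      by simp
    then show ?case using V_zero by auto
  next
    case (step c x y)
    then obtain k where k: "1 \<le> k" "x \<in> height_space a k" by auto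
    from step obtain N where N: "\<forall>M\<ge>N. height_annihilator a M y = 0" by auto
    have x: "x \<in> V" "act (rho_check n) x = (a - of_nat k) *s x" using k by (auto simp: height_space_def)
    have "height_annihilator a M x = 0" if "M \<ge> k" for M
    proof -
      have "(\<Prod>j=1..M. a - of_nat k - a + of_nat j :: complex) = 0"
        using that k by (intro prod_zero) (auto intro!: bexI[of _ k])
      then show ?thesis by (simp add: height_annihilator_eigenvector[OF x])
    qed
    then have "\<forall>M\<ge>max k N. height_annihilator a M (c *s x + y) = 0"
      using N x step by (auto simp: height_annihilator_linear)
    moreover have "c *s x + y \<in> V" using x step by (auto intro!: V_add V_scale)
    ultimately show ?case by blast
  qed
  then obtain N where "height_annihilator a N v = 0" by auto
  then have "(\<Prod>j=1..N. of_nat j :: complex) = 0"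
    using v by (simp add: height_annihilator_eigenvector[of v a])
  then show False by (simp add: prod_zero_iff)
qed

end

section \<open>Uniqueness of the irreducible representation with a given highest weight\<close>

locale sl_rep_pair =
  R1: sl_rep scale1 n V1 act1 + R2: sl_rep scale2 n V2 act2
  for scale1 :: "complex \<Rightarrow> 'v::ab_group_add \<Rightarrow> 'v"
    and scale2 :: "complex \<Rightarrow> 'w::ab_group_add \<Rightarrow> 'w"
    and n V1 act1 V2 act2
begin

text \<open>The subspace of \<open>V1 \<times> V2\<close> generated by \<open>(v, w)\<close> under the strictly lower triangular
  matrices, written as a relation because it turns out to be the graph of the isomorphism sought.\<close>

inductive joint :: "'v \<Rightarrow> 'w \<Rightarrow> 'v \<Rightarrow> 'w \<Rightarrow> bool" for v w where
  gen: "joint v w v w"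
| add: "joint v w x y \<Longrightarrow> joint v w x' y' \<Longrightarrow> joint v w (x + x') (y + y')"
| scale: "joint v w x y \<Longrightarrow> joint v w (scale1 c x) (scale2 c y)"
| lower: "joint v w x y \<Longrightarrow> F \<in> strictly_lower n \<Longrightarrow> joint v w (act1 F x) (act2 F y)"

lemma joint_zero: "joint v w 0 0"
  using scale[OF gen, of v w 0] by simp

lemma joint_diff: "joint v w x y \<Longrightarrow> joint v w x' y' \<Longrightarrow> joint v w (x - x') (y - y')"
  using add[OF _ scale[of v w x' y' "-1"], of x y] by simp

lemma joint_closed:
  assumes "joint v w x y" "v \<in> V1" "w \<in> V2"
  shows "x \<in> V1 \<and> y \<in> V2"
  using assms
  by (induction rule: joint.induct)
    (auto intro: R1.V_add R2.V_add R1.V_scale R2.V_scale R1.act_closed R2.act_closed strictly_lower_sl)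

text \<open>The strictly lower triangular matrices already generate the whole subrepresentation. On
  \<open>(v, w)\<close> the upper triangular part acts by zero and the diagonal part by the same scalar in
  both components. On \<open>F (x, y)\<close> with \<open>F\<close> lower triangular, \<open>X F = F X + [X, F]\<close> moves
  \<open>X\<close> past \<open>F\<close>; the induction hypothesis has to range over all \<open>X\<close>, as it is also used for \<open>[X, F]\<close>.\<close>

lemma joint_act:
  assumes v: "v \<in> R1.weight_space lam" "\<forall>X\<in>nilradical n. act1 X v = 0"
    and w: "w \<in> R2.weight_space lam" "\<forall>X\<in>nilradical n. act2 X w = 0"
    and j: "joint v w x y" and X: "X \<in> sl n"
  shows "joint v w (act1 X x) (act2 X y)"
proof -
  have vV: "v \<in> V1" and wV: "w \<in> V2"
    using v w by (auto simp: R1.weight_space_def R2.weight_space_def)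
  show ?thesis using j X
  proof (induction arbitrary: X rule: joint.induct)
    case gen
    obtain L H N where d: "X = L + (H + N)" "L \<in> strictly_lower n" "H \<in> cartan n" "N \<in> nilradical n"
      using sl_triangular_decomposition[OF gen] .
    note s = strictly_lower_sl[OF d(2)] cartan_sl[OF d(3)] nilradical_sl[OF d(4)]
    have "act1 X v = act1 L v + scale1 (lam H) v"
      using v d s vV by (simp add: R1.act_add_left sl_add R1.weight_space_def)
    moreover have "act2 X w = act2 L w + scale2 (lam H) w"
      using w d s wV by (simp add: R2.act_add_left sl_add R2.weight_space_def)
    ultimately show ?case
      using d by (auto intro: joint.intros)
  next
    case (add x y x' y')
    then show ?case
      using joint_closed[OF _ vV wV]
      by (simp add: R1.act_add_right R2.act_add_right joint.add)
  next
    case (scale x y c)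
    then show ?case
      using joint_closed[OF _ vV wV]
      by (simp add: R1.act_scale_right R2.act_scale_right joint.scale)
  next
    case (lower x y F)
    have F: "F \<in> sl n" using lower by (simp add: strictly_lower_sl)
    have xy: "x \<in> V1" "y \<in> V2" using joint_closed[OF lower(1) vV wV] by auto
    have "act1 X (act1 F x) = act1 F (act1 X x) + act1 (lie_bracket X F) x"
      using R1.act_bracket[OF lower.prems F xy(1)] by simp
    moreover have "act2 X (act2 F y) = act2 F (act2 X y) + act2 (lie_bracket X F) y"
      using R2.act_bracket[OF lower.prems F xy(2)] by simp
    ultimately show ?case
      using joint.add[OF joint.lower[OF lower.IH[OF lower.prems] lower(2)]
          lower.IH[OF sl_lie_bracket[OF lower.prems F]]] by simp
  qed
qed

text \<open>The same coefficient \<open>c\<close> serves both components; this is what keeps \<open>(v, 0)\<close> and \<open>(0, w)\<close>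
  out of the generated subrepresentation.\<close>

lemma joint_leading_coefficient:
  assumes v: "v \<in> R1.height_space a 0" and w: "w \<in> R2.height_space a 0" and j: "joint v w x y"
  shows "\<exists>c. x - scale1 c v \<in> R1.below a 1 \<and> y - scale2 c w \<in> R2.below a 1"
  using j
proof (induction rule: joint.induct)
  case gen
  then show ?case by (auto intro!: exI[of _ 1] simp: R1.below_zero R2.below_zero)
next
  case (add x y x' y')
  then obtain c c' where c: "x - scale1 c v \<in> R1.below a 1" "y - scale2 c w \<in> R2.below a 1"
    "x' - scale1 c' v \<in> R1.below a 1" "y' - scale2 c' w \<in> R2.below a 1" by auto
  have "x + x' - scale1 (c + c') v = (x - scale1 c v) + (x' - scale1 c' v)"
    "y + y' - scale2 (c + c') w = (y - scale2 c w) + (y' - scale2 c' w)"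
    by (simp_all add: R1.scale_left_distrib R2.scale_left_distrib)
  with R1.below_add[OF c(1,3)] R2.below_add[OF c(2,4)] show ?case by metis
next
  case (scale x y b)
  then obtain c where c: "x - scale1 c v \<in> R1.below a 1" "y - scale2 c w \<in> R2.below a 1" by auto
  have "scale1 b x - scale1 (b * c) v = scale1 b (x - scale1 c v)"
    "scale2 b y - scale2 (b * c) w = scale2 b (y - scale2 c w)"
    by (auto simp: R1.scale_right_diff_distrib R2.scale_right_diff_distrib)
  with R1.below_scale[OF c(1), of b] R2.below_scale[OF c(2), of b] show ?case by metis
next
  case (lower x y F)
  then obtain c where c: "x - scale1 c v \<in> R1.below a 1" "y - scale2 c w \<in> R2.below a 1" by auto
  have "(x - scale1 c v) + scale1 c v \<in> R1.below a 0"
    using c R1.below_Suc[of a 0] R1.height_space_below[OF v]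
    by (intro R1.below_add R1.below_scale) auto
  moreover have "(y - scale2 c w) + scale2 c w \<in> R2.below a 0"
    using c R2.below_Suc[of a 0] R2.height_space_below[OF w]
    by (intro R2.below_add R2.below_scale) auto
  \<comment> \<open>Applying \<open>F\<close> lowers the height, so no multiple of \<open>(v, w)\<close> remains.\<close>
  ultimately show ?case
    using R1.strictly_lower_below[OF lower(2), of x a 0] R2.strictly_lower_below[OF lower(2), of y a 0]
    by (intro exI[of _ 0]) simp
qed

text \<open>The kernels of the two projections are subrepresentations of \<open>V1\<close> and \<open>V2\<close>. They do not contain
  \<open>v\<close> and \<open>w\<close>, so irreducibility makes them zero.\<close>

lemma joint_zero_iff:
  assumes irr1: "R1.irreducible_rep" and irr2: "R2.irreducible_rep"
    and v: "v \<in> R1.weight_space lam" "\<forall>X\<in>nilradical n. act1 X v = 0" "v \<noteq> 0"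
    and w: "w \<in> R2.weight_space lam" "\<forall>X\<in>nilradical n. act2 X w = 0" "w \<noteq> 0"
    and j: "joint v w x y"
  shows "x = 0 \<longleftrightarrow> y = 0"
proof -
  define a where "a = lam (rho_check n)"
  have vV: "v \<in> V1" "act1 (rho_check n) v = scale1 a v"
    and wV: "w \<in> V2" "act2 (rho_check n) w = scale2 a w"
    using v w rho_check_cartan by (auto simp: R1.weight_space_def R2.weight_space_def a_def)
  have h: "v \<in> R1.height_space a 0" "w \<in> R2.height_space a 0"
    using vV wV by (auto simp: R1.height_space_def R2.height_space_def)
  note nb = R1.not_below[OF vV(1) v(3) vV(2)] R2.not_below[OF wV(1) w(3) wV(2)]
  note act = joint_act[OF v(1,2) w(1,2)]
  note closed = joint_closed[OF _ vV(1) wV(1)]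
  have n1: "\<not> joint v w v 0"
  proof
    assume "joint v w v 0"
    then obtain c where c: "v - scale1 c v \<in> R1.below a 1" "0 - scale2 c w \<in> R2.below a 1"
      using joint_leading_coefficient[OF h] by blast
    have "scale2 (- inverse c) (0 - scale2 c w) \<in> R2.below a 1"
      using c(2) by (rule R2.below_scale)
    then have "c = 0" using nb by (cases "c = 0") auto
    then show False using c nb by simp
  qed
  have n2: "\<not> joint v w 0 w"
  proof
    assume "joint v w 0 w"
    then obtain c where c: "0 - scale1 c v \<in> R1.below a 1" "w - scale2 c w \<in> R2.below a 1"
      using joint_leading_coefficient[OF h] by blast
    have "scale1 (- inverse c) (0 - scale1 c v) \<in> R1.below a 1"
      using c(1) by (rule R1.below_scale)
    then have "c = 0" using nb by (cases "c = 0") auto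
    then show False using c nb by simp
  qed
  have "R1.subrep {x. joint v w x 0}"
    unfolding R1.subrep_def R1.subspace_def
    using act[of _ 0] closed[of _ 0] joint.add[of v w _ 0 _ 0] joint.scale[of v w _ 0]
    by (auto simp: joint_zero R2.act_zero_right)
  then have 1: "{x. joint v w x 0} = {0}"
    using irr1 n1 vV unfolding R1.irreducible_rep_def by blast
  have "R2.subrep {y. joint v w 0 y}"
    unfolding R2.subrep_def R2.subspace_def
    using act[of 0] closed[of 0] joint.add[of v w 0 _ 0 _] joint.scale[of v w 0 _]
    by (auto simp: joint_zero R1.act_zero_right)
  then have 2: "{y. joint v w 0 y} = {0}"
    using irr2 n2 wV unfolding R2.irreducible_rep_def by blast
  show ?thesis using 1 2 j by blast
qed

text \<open>The images of the two projections are subrepresentations containing the nonzero vectors \<open>v\<close> and \<open>w\<close>.\<close>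

lemma joint_total:
  assumes irr1: "R1.irreducible_rep" and irr2: "R2.irreducible_rep"
    and v: "v \<in> R1.weight_space lam" "\<forall>X\<in>nilradical n. act1 X v = 0" "v \<noteq> 0"
    and w: "w \<in> R2.weight_space lam" "\<forall>X\<in>nilradical n. act2 X w = 0" "w \<noteq> 0"
  shows "\<And>x. x \<in> V1 \<Longrightarrow> \<exists>y. joint v w x y" and "\<And>y. y \<in> V2 \<Longrightarrow> \<exists>x. joint v w x y"
proof -
  have V: "v \<in> V1" "w \<in> V2" using v w by (auto simp: R1.weight_space_def R2.weight_space_def)
  note act = joint_act[OF v(1,2) w(1,2)]
  note closed = joint_closed[OF _ V]
  have "R1.subrep {x. \<exists>y. joint v w x y}"
    unfolding R1.subrep_def R1.subspace_def
    using act closed by (auto intro: joint_zero joint.add joint.scale)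
  then have "{x. \<exists>y. joint v w x y} = V1"
    using irr1 v(3) joint.gen[of v w] unfolding R1.irreducible_rep_def by blast
  then show "\<And>x. x \<in> V1 \<Longrightarrow> \<exists>y. joint v w x y" by blast
  have "R2.subrep {y. \<exists>x. joint v w x y}"
    unfolding R2.subrep_def R2.subspace_def
    using act closed by (auto intro: joint_zero joint.add joint.scale)
  then have "{y. \<exists>x. joint v w x y} = V2"
    using irr2 w(3) joint.gen[of v w] unfolding R2.irreducible_rep_def by blast
  then show "\<And>y. y \<in> V2 \<Longrightarrow> \<exists>x. joint v w x y" by blast
qed

text \<open>An irreducible representation is determined by its highest weight: \<open>joint v w\<close> is the graph of
  an equivariant linear bijection, so it matches weight spaces. To have a map on the whole ambient space,
  as the dimension theory of \<^locale>\<open>vector_space_pair\<close> expects, a basis of the weight space is sent along the graph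
  and the result is extended linearly.\<close>

theorem dim_weight_space_eq:
  assumes irr: "R1.irreducible_rep" "R2.irreducible_rep"
    and hw: "R1.has_highest_weight lam" "R2.has_highest_weight lam"
  shows "R1.dim (R1.weight_space \<mu>) = R2.dim (R2.weight_space \<mu>)"
proof -
  obtain v where v: "v \<in> R1.weight_space lam" "\<forall>X\<in>nilradical n. act1 X v = 0" "v \<noteq> 0"
    using hw unfolding R1.has_highest_weight_def by blast
  obtain w where w: "w \<in> R2.weight_space lam" "\<forall>X\<in>nilradical n. act2 X w = 0" "w \<noteq> 0"
    using hw unfolding R2.has_highest_weight_def by blast
  have V: "v \<in> V1" "w \<in> V2" using v w by (auto simp: R1.weight_space_def R2.weight_space_def)
  note act = joint_act[OF v(1,2) w(1,2)]
  note zero_iff = joint_zero_iff[OF irr v w]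
  note total = joint_total[OF irr v w]
  note closed = joint_closed[OF _ V]
  interpret vector_space_pair scale1 scale2 ..
  have weight_iff: "x \<in> R1.weight_space \<mu> \<longleftrightarrow> y \<in> R2.weight_space \<mu>" if j: "joint v w x y" for x y
  proof -
    have "act1 H x = scale1 (\<mu> H) x \<longleftrightarrow> act2 H y = scale2 (\<mu> H) y" if "H \<in> cartan n" for H
      using zero_iff[OF joint_diff[OF act[OF j cartan_sl[OF that]] joint.scale[OF j, of "\<mu> H"]]]
      by simp
    then show ?thesis using closed[OF j] by (auto simp: R1.weight_space_def R2.weight_space_def)
  qed
  obtain B where B: "B \<subseteq> R1.weight_space \<mu>" "R1.independent B" "R1.weight_space \<mu> \<subseteq> R1.span B"
    using R1.maximal_independent_subset .
  have "\<forall>b\<in>B. \<exists>y. joint v w b y" using B total by (auto simp: R1.weight_space_def)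
  then obtain f where f: "\<forall>b\<in>B. joint v w b (f b)" by metis
  obtain g where g: "Vector_Spaces.linear scale1 scale2 g" "\<forall>b\<in>B. g b = f b"
    using linear_independent_extend[OF B(2), of f] by blast
  interpret g: Vector_Spaces.linear scale1 scale2 g by (rule g(1))
  have graph: "joint v w x (g x)" if "x \<in> R1.span B" for x
    using that
  proof (induction rule: R1.span_induct_alt)
    case base
    then show ?case by (simp add: g.zero joint_zero)
  next
    case (step c x y)
    then show ?case using f g(2) by (auto simp: g.add g.scale intro!: joint.add joint.scale)
  qed
  have inj: "inj_on g (R1.span B)"
  proof (rule inj_onI)
    fix x y assume "x \<in> R1.span B" "y \<in> R1.span B" "g x = g y"
    then have "joint v w (x - y) 0" using joint_diff[OF graph graph, of x y] by simp
    then show "x = y" using zero_iff by fastforce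
  qed
  have ind: "R2.independent (g ` B)"
    using linear_independent_injective_image[OF g(1) B(2) inj] .
  have sub: "g ` B \<subseteq> R2.weight_space \<mu>"
    using weight_iff[OF graph] B R1.span_base by blast
  have span: "R2.weight_space \<mu> \<subseteq> R2.span (g ` B)"
  proof
    fix y assume y: "y \<in> R2.weight_space \<mu>"
    then obtain x where x: "joint v w x y" using total(2)[of y] by (auto simp: R2.weight_space_def)
    then have xB: "x \<in> R1.span B" using weight_iff y B by blast
    have "joint v w 0 (y - g x)" using joint_diff[OF x graph[OF xB]] by simp
    then have "y = g x" using zero_iff by fastforce
    then show "y \<in> R2.span (g ` B)" using xB by (simp add: g.span_image)
  qed
  have "R1.dim (R1.weight_space \<mu>) = card B" using B by (intro R1.dim_unique[of B]) auto
  also have "\<dots> = card (g ` B)"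
    using inj_on_subset[OF inj R1.span_superset] by (simp add: card_image)
  also have "\<dots> = R2.dim (R2.weight_space \<mu>)"
    using R2.dim_unique[OF sub span ind] by simp
  finally show ?thesis .
qed

end

section \<open>Matrix units and ideals of the special linear algebra\<close>

definition mat_unit :: "nat \<Rightarrow> nat \<Rightarrow> nat \<Rightarrow> complex mat" where
  "mat_unit n p q = mat n n (\<lambda>(i, j). if i = p \<and> j = q then 1 else 0)"

definition coroot :: "nat \<Rightarrow> nat \<Rightarrow> nat \<Rightarrow> complex mat" where
  "coroot n p q = mat n n (\<lambda>(i, j). if i = j then of_bool (i = p) - of_bool (i = q) else 0)"

text \<open>A spanning family of \<open>sl n\<close> indexed by matrix positions, so that \<open>A\<close> is the combination of the
  family with its own entries as coefficients (\<open>vec_of_mat_expansion\<close>). It is a basis together with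
  the zero matrix at position \<open>(n - 1, n - 1)\<close>, whose entry the trace condition determines.\<close>

definition sl_basis_mat :: "nat \<Rightarrow> nat \<Rightarrow> nat \<Rightarrow> complex mat" where
  "sl_basis_mat n p q = (if p = q then coroot n p (n - 1) else mat_unit n p q)"

lemma mat_unit_carrier [simp]: "mat_unit n p q \<in> carrier_mat n n"
  by (simp add: mat_unit_def)

lemma mat_unit_index [simp]:
  "i < n \<Longrightarrow> j < n \<Longrightarrow> mat_unit n p q $$ (i, j) = (if i = p \<and> j = q then 1 else 0)"
  by (simp add: mat_unit_def)

lemma mat_unit_dim [simp]: "dim_row (mat_unit n p q) = n" "dim_col (mat_unit n p q) = n"
  by (simp_all add: mat_unit_def)

lemma mat_unit_sl: "p \<noteq> q \<Longrightarrow> mat_unit n p q \<in> sl n"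
  by (auto simp: mat_unit_def sl_def intro!: sum.neutral)

lemma coroot_cartan:
  assumes "p < n" "q < n" shows "coroot n p q \<in> cartan n"
  using assms
  by (auto simp: coroot_def cartan_def sl_def diagonal_mat_def sum_subtractf of_bool_def)

lemma sl_basis_mat_sl: "p < n \<Longrightarrow> q < n \<Longrightarrow> sl_basis_mat n p q \<in> sl n"
  by (auto simp: sl_basis_mat_def mat_unit_sl intro!: cartan_sl[OF coroot_cartan])

lemma lie_bracket_mat_unit_index:
  assumes A: "A \<in> carrier_mat n n" and pq: "p < n" "q < n" and ij: "i < n" "j < n"
  shows "lie_bracket (mat_unit n p q) A $$ (i, j) =
    (if i = p then A $$ (q, j) else 0) - (if j = q then A $$ (i, p) else 0)"
proof -
  have "(\<Sum>k<n. mat_unit n p q $$ (i, k) * A $$ (k, j)) = (\<Sum>k<n. if k = q then if i = p then A $$ (q, j) else 0 else 0)"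
    using ij by (intro sum.cong) (auto simp: mat_unit_def)
  moreover have "(\<Sum>k<n. A $$ (i, k) * mat_unit n p q $$ (k, j)) = (\<Sum>k<n. if k = p then if j = q then A $$ (i, p) else 0 else 0)"
    using ij by (intro sum.cong) (auto simp: mat_unit_def)
  ultimately show ?thesis
    using pq lie_bracket_index[OF mat_unit_carrier A ij] by simp
qed

text \<open>With \<open>E\<close> the matrix unit at \<open>(q, p)\<close>, \<open>[E, [E, A]] = E\<^sup>2 A - 2 E A E + A E\<^sup>2\<close>, where
  \<open>E\<^sup>2 = 0\<close> and \<open>E A E\<close> is the multiple of \<open>E\<close> by the entry of \<open>A\<close> at \<open>(p, q)\<close>. So two brackets
  isolate a single entry.\<close>

lemma double_bracket_mat_unit:
  assumes A: "A \<in> carrier_mat n n" and pq: "p < n" "q < n" "p \<noteq> q"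
  shows "lie_bracket (mat_unit n q p) (lie_bracket (mat_unit n q p) A) = (- 2 * A $$ (p, q)) \<cdot>\<^sub>m mat_unit n q p"
proof (rule eq_matI)
  let ?E = "mat_unit n q p"
  have B: "lie_bracket ?E A \<in> carrier_mat n n" using A by (simp add: lie_bracket_carrier)
  fix i j assume "i < dim_row ((- 2 * A $$ (p, q)) \<cdot>\<^sub>m ?E)" "j < dim_col ((- 2 * A $$ (p, q)) \<cdot>\<^sub>m ?E)"
  then have ij: "i < n" "j < n" by auto
  show "lie_bracket ?E (lie_bracket ?E A) $$ (i, j) = ((- 2 * A $$ (p, q)) \<cdot>\<^sub>m ?E) $$ (i, j)"
    using ij pq
    by (auto simp: lie_bracket_mat_unit_index[OF B] lie_bracket_mat_unit_index[OF A])
qed (use A in auto)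

locale sl_ideal =
  fixes n :: nat and I :: "complex mat set"
  assumes ideal_sl: "I \<subseteq> sl n"
    and ideal_smult: "A \<in> I \<Longrightarrow> c \<cdot>\<^sub>m A \<in> I"
    and ideal_bracket: "X \<in> sl n \<Longrightarrow> A \<in> I \<Longrightarrow> lie_bracket X A \<in> I"
begin

lemma ideal_cancel:
  assumes "c \<cdot>\<^sub>m A \<in> I" "c \<noteq> 0" shows "A \<in> I"
proof -
  have "inverse c \<cdot>\<^sub>m (c \<cdot>\<^sub>m A) = A"
    using assms(2) by (intro eq_matI) auto
  then show ?thesis using ideal_smult[OF assms(1), of "inverse c"] by simp
qed

lemma transposed_unit_mem:
  assumes A: "A \<in> I" and pq: "p < n" "q < n" "p \<noteq> q" and nz: "A $$ (p, q) \<noteq> 0"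
  shows "mat_unit n q p \<in> I"
proof -
  have "A \<in> carrier_mat n n" using A ideal_sl sl_carrier by blast
  note d = double_bracket_mat_unit[OF this pq]
  have E: "mat_unit n q p \<in> sl n" using pq by (simp add: mat_unit_sl)
  have "(- 2 * A $$ (p, q)) \<cdot>\<^sub>m mat_unit n q p \<in> I"
    using ideal_bracket[OF E ideal_bracket[OF E A]] unfolding d .
  then show ?thesis by (rule ideal_cancel) (use nz in simp)
qed

lemma unit_mem_transpose:
  assumes "mat_unit n p q \<in> I" "p < n" "q < n" "p \<noteq> q"
  shows "mat_unit n q p \<in> I"
  using transposed_unit_mem[OF assms] assms by (simp add: mat_unit_def)

text \<open>An off-diagonal entry of \<open>A\<close> is isolated by a double bracket. If there is none, then \<open>A\<close> is
  diagonal; being nonzero of trace zero it is not scalar, and bracketing with a matrix unit at two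
  positions with different diagonal entries gives a nonzero multiple of that unit.\<close>

lemma exists_unit_mem:
  assumes A: "A \<in> I" "A \<noteq> 0\<^sub>m n n"
  shows "\<exists>p q. p < n \<and> q < n \<and> p \<noteq> q \<and> mat_unit n p q \<in> I"
proof (cases "\<exists>p q. p < n \<and> q < n \<and> p \<noteq> q \<and> A $$ (p, q) \<noteq> 0")
  case True
  then obtain p q where pq: "p < n" "q < n" "p \<noteq> q" "A $$ (p, q) \<noteq> 0" by auto
  then have "mat_unit n q p \<in> I" by (intro transposed_unit_mem[OF A(1)])
  with pq show ?thesis by (intro exI[of _ q] exI[of _ p]) simp
next
  case False
  have sl: "A \<in> sl n" using A ideal_sl by auto
  then have c: "A \<in> carrier_mat n n" by (rule sl_carrier)
  have "\<exists>i<n. \<exists>j<n. A $$ (i, i) \<noteq> A $$ (j, j)"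
  proof (rule ccontr)
    assume const: "\<not> ?thesis"
    have "A $$ (i, i) = 0" if i: "i < n" for i
    proof -
      have "A $$ (j, j) = A $$ (i, i)" if "j < n" for j
        using const i that by blast
      then have "(\<Sum>j<n. A $$ (j, j)) = (\<Sum>j<n. A $$ (i, i))"
        by (intro sum.cong) auto
      then show ?thesis using sl i by (simp add: sl_def)
    qed
    then have "A = 0\<^sub>m n n"
      using False c by (intro eq_matI) auto
    then show False using A by simp
  qed
  then obtain i j where ij: "i < n" "j < n" "A $$ (i, i) \<noteq> A $$ (j, j)" by blast
  then have ne: "i \<noteq> j" by auto
  have "lie_bracket (mat_unit n i j) A = (A $$ (j, j) - A $$ (i, i)) \<cdot>\<^sub>m mat_unit n i j"
    using c ij ne False
    by (intro eq_matI) (auto simp: lie_bracket_mat_unit_index)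
  then have "(A $$ (j, j) - A $$ (i, i)) \<cdot>\<^sub>m mat_unit n i j \<in> I"
    using ideal_bracket[OF mat_unit_sl[OF ne] A(1)] by simp
  then have "mat_unit n i j \<in> I" by (rule ideal_cancel) (use ij in simp)
  then show ?thesis using ij ne by blast
qed

lemma unit_mem_row:
  assumes "mat_unit n p q \<in> I" "p < n" "q < n" "p \<noteq> q" "a < n" "a \<noteq> q"
  shows "mat_unit n a q \<in> I"
proof (cases "a = p")
  case False
  have "lie_bracket (mat_unit n a p) (mat_unit n p q) = mat_unit n a q"
    using assms False
    by (intro eq_matI) (auto simp: lie_bracket_mat_unit_index)
  then show ?thesis
    using ideal_bracket[OF mat_unit_sl[OF False] assms(1)] by simp
qed (use assms in simp)

lemma unit_mem_column:
  assumes "mat_unit n p q \<in> I" "p < n" "q < n" "p \<noteq> q" "b < n" "b \<noteq> p"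
  shows "mat_unit n p b \<in> I"
  using unit_mem_transpose[OF assms(1-4)] unit_mem_row[of q p b] unit_mem_transpose[of b p] assms by simp

text \<open>The row and the column of a matrix unit can be changed one at a time as long as no diagonal
  position is met on the way. When both orders meet the diagonal, the target is the transposed unit.\<close>

lemma unit_mem:
  assumes A: "A \<in> I" "A \<noteq> 0\<^sub>m n n" and ab: "a < n" "b < n" "a \<noteq> b"
  shows "mat_unit n a b \<in> I"
proof -
  obtain p q where pq: "p < n" "q < n" "p \<noteq> q" "mat_unit n p q \<in> I"
    using exists_unit_mem[OF A] by blast
  consider "a \<noteq> q" | "a = q" "b \<noteq> p" | "a = q" "b = p" by blast
  then show ?thesis
  proof cases
    case 1
    then show ?thesis using unit_mem_row[of p q a] unit_mem_column[of a q b] pq ab by auto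
  next
    case 2
    then show ?thesis using unit_mem_column[of p q b] unit_mem_row[of p b a] pq ab by auto
  next
    case 3
    then show ?thesis using unit_mem_transpose[of p q] pq by auto
  qed
qed

text \<open>Simplicity of \<open>sl n\<close>, up to linear combinations: an ideal with a nonzero element contains the
  whole spanning family. The diagonal members arise as brackets of transposed matrix units.\<close>

lemma sl_basis_mat_mem:
  assumes A: "A \<in> I" "A \<noteq> 0\<^sub>m n n" and ab: "a < n" "b < n"
  shows "sl_basis_mat n a b \<in> I"
proof (cases "a = b")
  case False
  then show ?thesis using unit_mem[OF A ab] by (simp add: sl_basis_mat_def)
next
  case True
  let ?m = "n - 1"
  have m: "?m < n" using ab by auto
  show ?thesis
  proof (cases "a = ?m")
    case True
    have "coroot n ?m ?m = 0 \<cdot>\<^sub>m A"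
      using A ideal_sl sl_carrier[of A n] by (intro eq_matI) (auto simp: coroot_def)
    then show ?thesis using ideal_smult[OF A(1), of 0] True \<open>a = b\<close> by (simp add: sl_basis_mat_def)
  next
    case False
    have "lie_bracket (mat_unit n a ?m) (mat_unit n ?m a) = coroot n a ?m"
      using ab m False
      by (intro eq_matI) (auto simp: lie_bracket_mat_unit_index coroot_def)
    moreover have "mat_unit n ?m a \<in> I" using unit_mem[OF A m ab(1)] False by simp
    ultimately have "coroot n a ?m \<in> I"
      using ideal_bracket[OF mat_unit_sl[OF False, of n], of "mat_unit n ?m a"] by simp
    then show ?thesis using \<open>a = b\<close> by (simp add: sl_basis_mat_def)
  qed
qed

end

section \<open>The adjoint representation\<close>

definition vec_of_mat :: "nat \<Rightarrow> complex mat \<Rightarrow> cfun" where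
  "vec_of_mat n A = (\<lambda>k. if k < n * n then A $$ (k div n, k mod n) else 0)"

definition mat_of_vec :: "nat \<Rightarrow> cfun \<Rightarrow> complex mat" where
  "mat_of_vec n f = mat n n (\<lambda>(i, j). f (i * n + j))"

definition ad_space :: "nat \<Rightarrow> cfun set" where
  "ad_space n = vec_of_mat n ` sl n"

definition ad_act :: "nat \<Rightarrow> complex mat \<Rightarrow> cfun \<Rightarrow> cfun" where
  "ad_act n X f = vec_of_mat n (lie_bracket X (mat_of_vec n f))"

lemma pair_index_less: "i < n \<Longrightarrow> j < n \<Longrightarrow> i * n + j < n * (n::nat)"
proof -
  assume "i < n" "j < n"
  then have "i * n + j < Suc i * n" by simp
  also have "\<dots> \<le> n * n" using \<open>i < n\<close> by (intro mult_le_mono1) simp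
  finally show ?thesis .
qed

lemma div_mod_less: "k < n * n \<Longrightarrow> k div n < n \<and> k mod n < (n::nat)"
  by (cases "n = 0") (auto simp: less_mult_imp_div_less)

lemma vec_of_mat_index: "i < n \<Longrightarrow> j < n \<Longrightarrow> vec_of_mat n A (i * n + j) = A $$ (i, j)"
  using pair_index_less[of i n j] by (simp add: vec_of_mat_def)

lemma mat_of_vec_of_mat: "A \<in> carrier_mat n n \<Longrightarrow> mat_of_vec n (vec_of_mat n A) = A"
  by (rule eq_matI) (auto simp: mat_of_vec_def vec_of_mat_index)

lemma vec_of_mat_inj: "inj_on (vec_of_mat n) (carrier_mat n n)"
  by (rule inj_on_inverseI[of _ "mat_of_vec n"]) (rule mat_of_vec_of_mat)

lemma vec_of_mat_add:
  "A \<in> carrier_mat n n \<Longrightarrow> B \<in> carrier_mat n n \<Longrightarrow> vec_of_mat n (A + B) = vec_of_mat n A + vec_of_mat n B"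
  using div_mod_less[of _ n] by (auto simp: vec_of_mat_def fun_eq_iff)

lemma vec_of_mat_diff:
  "A \<in> carrier_mat n n \<Longrightarrow> B \<in> carrier_mat n n \<Longrightarrow> vec_of_mat n (A - B) = vec_of_mat n A - vec_of_mat n B"
  using div_mod_less[of _ n] by (auto simp: vec_of_mat_def fun_eq_iff)

lemma vec_of_mat_smult:
  "A \<in> carrier_mat n n \<Longrightarrow> vec_of_mat n (c \<cdot>\<^sub>m A) = cscale c (vec_of_mat n A)"
  using div_mod_less[of _ n] by (auto simp: vec_of_mat_def cscale_def fun_eq_iff)

lemma vec_of_mat_zero [simp]: "vec_of_mat n (0\<^sub>m n n) = 0"
  using div_mod_less[of _ n] by (auto simp: vec_of_mat_def fun_eq_iff)

lemma vec_of_mat_eq_zero_iff: "A \<in> carrier_mat n n \<Longrightarrow> vec_of_mat n A = 0 \<longleftrightarrow> A = 0\<^sub>m n n"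
  using inj_onD[OF vec_of_mat_inj, of n A "0\<^sub>m n n"] by auto

lemma ad_act_vec: "A \<in> sl n \<Longrightarrow> ad_act n X (vec_of_mat n A) = vec_of_mat n (lie_bracket X A)"
  by (simp add: ad_act_def mat_of_vec_of_mat sl_carrier)

interpretation cfun: vector_space cscale by (rule vector_space_cscale)

lemma sl_zero: "0\<^sub>m n n \<in> sl n" by (simp add: sl_def)

lemma subspace_ad_space: "cfun.subspace (ad_space n)"
  unfolding cfun.subspace_def ad_space_def
  by (auto simp: sl_carrier sl_add sl_smult simp flip: vec_of_mat_add vec_of_mat_smult vec_of_mat_zero[of n]
      intro!: imageI sl_zero simp del: vec_of_mat_zero)

lemma sl_rep_ad: "sl_rep cscale n (ad_space n) (ad_act n)"
proof unfold_locales
  show "cfun.subspace (ad_space n)" by (rule subspace_ad_space)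
qed (auto simp: ad_space_def ad_act_vec sl_lie_bracket sl_carrier sl_add sl_smult
    lie_bracket_add_right[of _ n] lie_bracket_add_left[of _ n]
    lie_bracket_smult_left[of _ n] lie_bracket_smult_right[of _ n] jacobi[of _ n]
    simp flip: vec_of_mat_add vec_of_mat_diff vec_of_mat_smult)

lemma sum_fun_apply: "(\<Sum>i\<in>A. f i) x = (\<Sum>i\<in>A. f i x)"
  by (induction A rule: infinite_finite_induct) auto

text \<open>Only the last diagonal entry needs an argument: the matrices \<open>coroot n p (n - 1)\<close> contribute minus
  the sum of the other diagonal entries there, which is the right value because the trace is zero.\<close>

lemma vec_of_mat_expansion:
  assumes A: "A \<in> sl n"
  shows "vec_of_mat n A = (\<Sum>p<n. \<Sum>q<n. cscale (A $$ (p, q)) (vec_of_mat n (sl_basis_mat n p q)))"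
proof (rule ext)
  fix k
  show "vec_of_mat n A k = (\<Sum>p<n. \<Sum>q<n. cscale (A $$ (p, q)) (vec_of_mat n (sl_basis_mat n p q))) k"
  proof (cases "k < n * n")
    case False
    then show ?thesis by (simp add: vec_of_mat_def cscale_def sum_fun_apply)
  next
    case True
    define i j where "i = k div n" "j = k mod n"
    have ij: "i < n" "j < n" using div_mod_less[OF True] by (auto simp: i_j_def)
    let ?m = "n - 1"
    let ?S = "\<Sum>p<n. \<Sum>q<n. A $$ (p, q) * sl_basis_mat n p q $$ (i, j)"
    have tr: "(\<Sum>p<n. A $$ (p, p)) = 0" using A by (simp add: sl_def)
    have "?S = A $$ (i, j)"
    proof (cases "i = j")
      case False
      have "A $$ (p, q) * sl_basis_mat n p q $$ (i, j) =
          (if q = j then if p = i then A $$ (i, j) else 0 else 0)" for p q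
        using ij False by (auto simp: sl_basis_mat_def coroot_def)
      then have "?S = (\<Sum>p<n. if p = i then A $$ (i, j) else 0)"
        using ij by simp
      then show ?thesis using ij by simp
    next
      case True
      have "?S = (\<Sum>p<n. \<Sum>q<n. if q = p then A $$ (p, p) * (of_bool (i = p) - of_bool (i = ?m)) else 0)"
        using ij True by (intro sum.cong) (auto simp: sl_basis_mat_def mat_unit_def coroot_def)
      also have "\<dots> = (\<Sum>p<n. A $$ (p, p) * of_bool (i = p)) - (\<Sum>p<n. A $$ (p, p)) * of_bool (i = ?m)"
        by (simp add: sum_subtractf sum_distrib_right right_diff_distrib)
      also have "\<dots> = (\<Sum>p<n. if p = i then A $$ (i, i) else 0)"
        unfolding tr by (auto intro!: sum.cong)
      finally show ?thesis using ij True by simp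
    qed
    then show ?thesis
      using True by (simp add: vec_of_mat_def cscale_def i_j_def sum_fun_apply)
  qed
qed

lemma ad_finite_dimensional: "sl_rep.finite_dimensional cscale (ad_space n)"
proof -
  interpret sl_rep cscale n "ad_space n" "ad_act n" by (rule sl_rep_ad)
  let ?B = "(\<lambda>(p, q). vec_of_mat n (sl_basis_mat n p q)) ` ({..<n} \<times> {..<n})"
  have "cfun.span ?B \<subseteq> ad_space n"
    by (rule cfun.span_minimal[OF _ subspace_ad_space]) (auto simp: ad_space_def sl_basis_mat_sl)
  moreover have "ad_space n \<subseteq> cfun.span ?B"
  proof
    fix x assume "x \<in> ad_space n"
    then obtain A where A: "A \<in> sl n" "x = vec_of_mat n A" by (auto simp: ad_space_def)
    show "x \<in> cfun.span ?B"
      unfolding A(2) vec_of_mat_expansion[OF A(1)]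
      by (intro cfun.span_sum cfun.span_scale cfun.span_base) auto
  qed
  ultimately show ?thesis
    unfolding finite_dimensional_def by (intro exI[of _ ?B]) auto
qed

lemma ad_irreducible:
  assumes n: "2 \<le> n"
  shows "sl_rep.irreducible_rep cscale n (ad_space n) (ad_act n)"
proof -
  interpret sl_rep cscale n "ad_space n" "ad_act n" by (rule sl_rep_ad)
  have "W = {0} \<or> W = ad_space n" if W: "subrep W" for W
  proof (rule disjCI)
    assume ne: "W \<noteq> ad_space n"
    have sub: "cfun.subspace W" and WV: "W \<subseteq> ad_space n"
      and act: "\<And>X w. X \<in> sl n \<Longrightarrow> w \<in> W \<Longrightarrow> ad_act n X w \<in> W"
      using W by (auto simp: subrep_def)
    interpret I: sl_ideal n "{A \<in> sl n. vec_of_mat n A \<in> W}"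
    proof
      fix X A assume "X \<in> sl n" "A \<in> {A \<in> sl n. vec_of_mat n A \<in> W}"
      then show "lie_bracket X A \<in> {A \<in> sl n. vec_of_mat n A \<in> W}"
        using act[of X "vec_of_mat n A"] by (auto simp: ad_act_vec sl_lie_bracket)
    qed (auto simp: sl_smult vec_of_mat_smult sl_carrier intro: cfun.subspace_scale[OF sub])
    show "W = {0}"
    proof (rule ccontr)
      assume "W \<noteq> {0}"
      then obtain x where "x \<in> W" "x \<noteq> 0" using cfun.subspace_0[OF sub] by blast
      then obtain A where A: "A \<in> {A \<in> sl n. vec_of_mat n A \<in> W}" "A \<noteq> 0\<^sub>m n n"
        using WV by (fastforce simp: ad_space_def)
      have "ad_space n \<subseteq> W"
      proof
        fix x assume "x \<in> ad_space n"
        then obtain C where C: "C \<in> sl n" "x = vec_of_mat n C" by (auto simp: ad_space_def)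
        show "x \<in> W"
          unfolding C(2) vec_of_mat_expansion[OF C(1)]
          using I.sl_basis_mat_mem[OF A]
          by (intro cfun.subspace_sum[OF sub] cfun.subspace_scale[OF sub]) auto
      qed
      then show False using WV ne by blast
    qed
  qed
  moreover have "ad_space n \<noteq> {0}"
  proof
    assume "ad_space n = {0}"
    then have "vec_of_mat n (mat_unit n 0 1) = 0"
      using mat_unit_sl[of 0 1 n] by (auto simp: ad_space_def)
    then have "mat_unit n 0 1 $$ (0, 1) = 0"
      using n vec_of_mat_index[of 0 n 1 "mat_unit n 0 1"] by simp
    then show False using n by (simp add: mat_unit_def)
  qed
  ultimately show ?thesis unfolding irreducible_rep_def by blast
qed

lemma ad_weight_space:
  "sl_rep.weight_space cscale n (ad_space n) (ad_act n) \<mu> =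
    vec_of_mat n ` {A \<in> sl n. \<forall>H\<in>cartan n. \<forall>i<n. \<forall>j<n.
      A $$ (i, j) \<noteq> 0 \<longrightarrow> \<mu> H = H $$ (i, i) - H $$ (j, j)}"
proof -
  interpret sl_rep cscale n "ad_space n" "ad_act n" by (rule sl_rep_ad)
  have "ad_act n H (vec_of_mat n A) = cscale (\<mu> H) (vec_of_mat n A) \<longleftrightarrow>
      (\<forall>i<n. \<forall>j<n. A $$ (i, j) \<noteq> 0 \<longrightarrow> \<mu> H = H $$ (i, i) - H $$ (j, j))"
    if A: "A \<in> sl n" and H: "H \<in> cartan n" for A H
  proof -
    note c = sl_carrier[OF A] sl_carrier[OF cartan_sl[OF H]]
    have "ad_act n H (vec_of_mat n A) = cscale (\<mu> H) (vec_of_mat n A) \<longleftrightarrow>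
        vec_of_mat n (lie_bracket H A) = vec_of_mat n (\<mu> H \<cdot>\<^sub>m A)"
      using A c by (simp add: ad_act_vec vec_of_mat_smult)
    also have "\<dots> \<longleftrightarrow> lie_bracket H A = \<mu> H \<cdot>\<^sub>m A"
      using c by (intro inj_on_eq_iff[OF vec_of_mat_inj] lie_bracket_carrier) auto
    also have "\<dots> \<longleftrightarrow> (\<forall>i<n. \<forall>j<n. lie_bracket H A $$ (i, j) = \<mu> H * A $$ (i, j))"
      using c by (auto simp: mat_eq_iff)
    also have "\<dots> \<longleftrightarrow> (\<forall>i<n. \<forall>j<n. A $$ (i, j) \<noteq> 0 \<longrightarrow> \<mu> H = H $$ (i, i) - H $$ (j, j))"
      using lie_bracket_cartan_index[OF H c(1)] by (auto simp: eq_commute[of "\<mu> H"])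
    finally show ?thesis .
  qed
  then show ?thesis unfolding weight_space_def unfolding ad_space_def by auto
qed

lemma eps_cartan: "H \<in> cartan n \<Longrightarrow> eps n i H = H $$ (i - 1, i - 1)"
  by (simp add: eps_def)

lemma ad_highest_weight:
  assumes n: "2 \<le> n"
  shows "sl_rep.has_highest_weight cscale n (ad_space n) (ad_act n) (highest_root n)"
proof -
  interpret sl_rep cscale n "ad_space n" "ad_act n" by (rule sl_rep_ad)
  let ?E = "mat_unit n 0 (n - 1)"
  have E: "?E \<in> sl n" using n by (intro mat_unit_sl) auto
  have "vec_of_mat n ?E \<in> weight_space (highest_root n)"
    unfolding ad_weight_space using E n
    by (intro imageI) (auto simp: mat_unit_def highest_root_def eps_cartan split: if_splits)
  moreover have "?E \<noteq> 0\<^sub>m n n"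
    using n by (auto simp: mat_unit_def mat_eq_iff)
  then have "vec_of_mat n ?E \<noteq> 0" by (simp add: vec_of_mat_eq_zero_iff)
  moreover have "ad_act n X (vec_of_mat n ?E) = 0" if X: "X \<in> nilradical n" for X
  proof -
    have c: "X \<in> carrier_mat n n" by (rule sl_carrier[OF nilradical_sl[OF X]])
    have z: "X $$ (i, j) = 0" if "i < n" "j \<le> i" for i j
      using X c that by (cases "i = j") (auto simp: nilradical_def borel_def upper_triangular_def)
    have "lie_bracket X ?E $$ (i, j) = 0" if "i < n" "j < n" for i j
    proof -
      have "X $$ (i, k) * ?E $$ (k, j) = 0" "?E $$ (i, k) * X $$ (k, j) = 0" if "k < n" for k
        using \<open>i < n\<close> \<open>j < n\<close> that n z[of i 0] z[of "n - 1" j] by auto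
      then have "(\<Sum>k<n. X $$ (i, k) * ?E $$ (k, j)) = 0" "(\<Sum>k<n. ?E $$ (i, k) * X $$ (k, j)) = 0"
        by (intro sum.neutral ballI; simp only: lessThan_iff)+
      then show ?thesis by (simp only: lie_bracket_index[OF c mat_unit_carrier that] diff_self)
    qed
    then have "lie_bracket X ?E = 0\<^sub>m n n" using c by (intro eq_matI) (auto simp: mat_unit_def)
    then show ?thesis using E by (simp add: ad_act_vec)
  qed
  ultimately show ?thesis unfolding has_highest_weight_def by blast
qed

theorem is_L_ad:
  "2 \<le> n \<Longrightarrow> is_L n (highest_root n) (ad_space n, ad_act n)"
  by (simp add: is_L_def sl_rep_ad ad_finite_dimensional ad_irreducible ad_highest_weight)

section \<open>Weight multiplicities\<close>

text \<open>Any model of \<open>L(\<lambda>)\<close> computes the multiplicities: the chosen one is a model too, since one exists, and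
  two models have weight spaces of equal dimension.\<close>

theorem weight_mult_eq_dim:
  assumes L: "is_L n lam (V, act)"
  shows "weight_mult n lam \<mu> = cfun.dim (sl_rep.weight_space cscale n V act \<mu>)"
proof -
  obtain V' act' where M: "irrep_L n lam = (V', act')" by fastforce
  have L': "is_L n lam (V', act')"
    using someI[of "is_L n lam", OF L] M by (simp add: irrep_L_def)
  interpret sl_rep_pair cscale cscale n V' act' V act
    using L L' by (simp add: is_L_def sl_rep_pair_def)
  show ?thesis
    using dim_weight_space_eq[of lam \<mu>] L L' by (simp add: weight_mult_def M is_L_def)
qed

text \<open>On the entry \<open>(i, j)\<close> with \<open>i \<noteq> j\<close> the matrix \<open>coroot n i j\<close> acts by the scalar \<open>2\<close>, so a matrix
  of weight \<open>0\<close> is diagonal. The coroots for \<open>(i, n - 1)\<close> with \<open>i < n - 1\<close> are a basis of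
  the Cartan subalgebra.\<close>

lemma dim_ad_zero_weight:
  assumes n: "1 \<le> n"
  shows "cfun.dim (sl_rep.weight_space cscale n (ad_space n) (ad_act n) 0) = n - 1"
proof -
  let ?W = "sl_rep.weight_space cscale n (ad_space n) (ad_act n) 0"
  let ?b = "\<lambda>i. vec_of_mat n (coroot n i (n - 1))"
  let ?B = "?b ` {..<n - 1}"
  have W: "?W = vec_of_mat n ` cartan n"
  proof -
    have "A \<in> cartan n \<longleftrightarrow> (\<forall>H\<in>cartan n. \<forall>i<n. \<forall>j<n.
        A $$ (i, j) \<noteq> 0 \<longrightarrow> (0::complex) = H $$ (i, i) - H $$ (j, j))" if A: "A \<in> sl n" for A
    proof
      assume "A \<in> cartan n"
      then show "\<forall>H\<in>cartan n. \<forall>i<n. \<forall>j<n. A $$ (i, j) \<noteq> 0 \<longrightarrow> 0 = H $$ (i, i) - H $$ (j, j)"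
        using cartan_index[of A n] by (metis diff_self)
    next
      assume *: "\<forall>H\<in>cartan n. \<forall>i<n. \<forall>j<n. A $$ (i, j) \<noteq> 0 \<longrightarrow> 0 = H $$ (i, i) - H $$ (j, j)"
      have "A $$ (i, j) = 0" if "i < n" "j < n" "i \<noteq> j" for i j
        using *[rule_format, OF coroot_cartan[of i n j], of i j] that by (auto simp: coroot_def)
      then show "A \<in> cartan n" using A by (auto simp: cartan_def diagonal_mat_def dest: sl_carrier)
    qed
    then show ?thesis unfolding ad_weight_space zero_fun_apply using cartan_sl by blast
  qed
  have coord: "?b i (k * n + k) = of_bool (k = i)" if "i < n - 1" "k < n - 1" for i k
    using that by (simp add: vec_of_mat_index coroot_def)
  have inj: "inj_on ?b {..<n - 1}"
  proof (rule inj_onI)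
    fix i k assume "i \<in> {..<n - 1}" "k \<in> {..<n - 1}" "?b i = ?b k"
    then show "i = k" using coord[of i i] coord[of k i] by (auto split: if_splits)
  qed
  have ind: "cfun.independent ?B"
  proof (rule cfun.independent_if_scalars_zero)
    fix f x assume s: "(\<Sum>x\<in>?B. cscale (f x) x) = 0" and "x \<in> ?B"
    then obtain k where k: "k < n - 1" "x = ?b k" by auto
    have "0 = (\<Sum>i<n - 1. cscale (f (?b i)) (?b i)) (k * n + k)"
      using s by (simp only: sum.reindex[OF inj] o_def zero_fun_apply)
    also have "\<dots> = (\<Sum>i<n - 1. if i = k then f (?b k) else 0)"
      unfolding sum_fun_apply using k coord by (intro sum.cong) (auto simp: cscale_def)
    finally show "f x = 0" using k by simp
  qed simp
  have sub: "?B \<subseteq> ?W" unfolding W by (auto intro!: imageI coroot_cartan)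
  have "?W \<subseteq> cfun.span ?B"
  proof
    fix x assume "x \<in> ?W"
    then obtain A where A: "A \<in> cartan n" "x = vec_of_mat n A" unfolding W by auto
    have zero: "coroot n (n - 1) (n - 1) = 0\<^sub>m n n" by (intro eq_matI) (auto simp: coroot_def)
    have mem: "cscale (A $$ (p, q)) (vec_of_mat n (sl_basis_mat n p q)) \<in> cfun.span ?B"
      if "p < n" "q < n" for p q
    proof -
      have "p < n - 1 \<or> p = n - 1" using that by linarith
      then consider "p \<noteq> q" | "p = q" "p < n - 1" | "p = q" "p = n - 1" by blast
      then show ?thesis
      proof cases
        case 1
        then show ?thesis using cartan_index[OF A(1) that] by (simp add: cfun.span_zero)
      next
        case 2
        then have "vec_of_mat n (sl_basis_mat n p q) \<in> ?B" by (simp add: sl_basis_mat_def)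
        then show ?thesis by (intro cfun.span_scale cfun.span_base)
      next
        case 3
        then have "vec_of_mat n (sl_basis_mat n p q) = 0"
          using zero vec_of_mat_zero[of n] by (simp only: sl_basis_mat_def if_True refl)
        then show ?thesis by (simp add: cfun.span_zero)
      qed
    qed
    show "x \<in> cfun.span ?B"
      unfolding A(2) vec_of_mat_expansion[OF cartan_sl[OF A(1)]]
      by (intro cfun.span_sum mem) auto
  qed
  moreover have "card ?B = n - 1" using card_image[OF inj] by (simp only: card_lessThan)
  ultimately show ?thesis using cfun.dim_unique[OF sub _ ind] by blast
qed

text \<open>Among all roots, only \<open>\<alpha>\<close> takes the value \<open>2\<close> on the coroot of \<open>\<alpha>\<close>; this separates the root
  spaces from each other and from the Cartan subalgebra.\<close>

lemma root_coroot_eq_two: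
  assumes "p < n" "q < n" "p \<noteq> q" "i \<noteq> j" "i < n" "j < n"
    and "coroot n p q $$ (i, i) - coroot n p q $$ (j, j) = 2"
  shows "i = p \<and> j = q"
  using assms by (auto simp: coroot_def of_bool_def split: if_splits)

lemma dim_ad_root:
  assumes ij: "i < n" "j < n" "i \<noteq> j"
  shows "cfun.dim (sl_rep.weight_space cscale n (ad_space n) (ad_act n) (eps n (Suc i) - eps n (Suc j))) = 1"
proof -
  let ?\<mu> = "eps n (Suc i) - eps n (Suc j)"
  let ?W = "sl_rep.weight_space cscale n (ad_space n) (ad_act n) ?\<mu>"
  let ?e = "vec_of_mat n (mat_unit n i j)"
  have "mat_unit n i j \<noteq> 0\<^sub>m n n" using ij by (auto simp: mat_unit_def mat_eq_iff)
  then have ne: "?e \<noteq> 0" by (simp add: vec_of_mat_eq_zero_iff)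
  have sub: "{?e} \<subseteq> ?W"
    unfolding ad_weight_space using ij
    by (auto simp: mat_unit_sl eps_cartan intro!: imageI)
  have "?W \<subseteq> cfun.span {?e}"
  proof
    fix x assume "x \<in> ?W"
    then obtain A where A: "A \<in> sl n" "x = vec_of_mat n A"
      and w: "\<And>H p q. H \<in> cartan n \<Longrightarrow> p < n \<Longrightarrow> q < n \<Longrightarrow> A $$ (p, q) \<noteq> 0 \<Longrightarrow>
        H $$ (i, i) - H $$ (j, j) = H $$ (p, p) - H $$ (q, q)"
      unfolding ad_weight_space by (auto simp: eps_cartan)
    have "A $$ (p, q) = 0" if pq: "p < n" "q < n" "\<not> (p = i \<and> q = j)" for p q
    proof (rule ccontr)
      assume nz: "A $$ (p, q) \<noteq> 0"
      have "coroot n i j $$ (p, p) - coroot n i j $$ (q, q) = 2"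
        using w[OF coroot_cartan[OF ij(1,2)] pq(1,2) nz] ij by (simp add: coroot_def)
      moreover from this have "p \<noteq> q" by auto
      ultimately show False using root_coroot_eq_two[OF ij _ pq(1,2)] pq by blast
    qed
    then have "A = A $$ (i, j) \<cdot>\<^sub>m mat_unit n i j"
      using sl_carrier[OF A(1)] by (intro eq_matI) (auto simp: mat_unit_def)
    then have "x = cscale (A $$ (i, j)) ?e" using A(2) by (metis vec_of_mat_smult mat_unit_carrier)
    then show "x \<in> cfun.span {?e}" by (simp add: cfun.span_scale cfun.span_base)
  qed
  moreover have "cfun.independent {?e}" using ne by (simp add: cfun.dependent_single)
  ultimately show ?thesis using sub by (intro cfun.dim_unique[of "{?e}"]) auto
qed

lemma ad_weight_space_trivial:
  assumes nz: "\<mu> \<noteq> 0" and root: "\<mu> \<notin> sl_roots n" and out: "\<And>X. X \<notin> cartan n \<Longrightarrow> \<mu> X = 0"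
  shows "sl_rep.weight_space cscale n (ad_space n) (ad_act n) \<mu> = {0}"
proof -
  let ?S = "{A \<in> sl n. \<forall>H\<in>cartan n. \<forall>i<n. \<forall>j<n.
      A $$ (i, j) \<noteq> 0 \<longrightarrow> \<mu> H = H $$ (i, i) - H $$ (j, j)}"
  have "A = 0\<^sub>m n n" if "A \<in> ?S" for A
  proof -
    from that have A: "A \<in> sl n" and w: "\<forall>H\<in>cartan n. \<forall>i<n. \<forall>j<n.
      A $$ (i, j) \<noteq> 0 \<longrightarrow> \<mu> H = H $$ (i, i) - H $$ (j, j)" by auto
    have "A $$ (i, j) = 0" if ij: "i < n" "j < n" for i j
    proof (rule ccontr)
      assume "A $$ (i, j) \<noteq> 0"
      then have "\<mu> X = (eps n (Suc i) - eps n (Suc j)) X" for X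
        using w ij out by (cases "X \<in> cartan n") (auto simp: eps_def)
      then have "\<mu> = eps n (Suc i) - eps n (Suc j)" by blast
      moreover have "eps n (Suc i) - eps n (Suc j) \<in> sl_roots n" if "i \<noteq> j"
        unfolding sl_roots_def using ij that by (intro CollectI exI[of _ "Suc i"] exI[of _ "Suc j"]) auto
      ultimately show False using nz root by (cases "i = j") auto
    qed
    then show ?thesis using sl_carrier[OF A] by (intro eq_matI) auto
  qed
  moreover have "0\<^sub>m n n \<in> ?S" using sl_zero by simp
  ultimately have "?S = {0\<^sub>m n n}" by blast
  then show ?thesis by (simp add: ad_weight_space)
qed

lemma root_nonzero:
  assumes ij: "i < n" "j < n" "i \<noteq> j"
  shows "eps n (Suc i) - eps n (Suc j) \<noteq> 0"
proof
  assume "eps n (Suc i) - eps n (Suc j) = 0"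
  then have "(eps n (Suc i) - eps n (Suc j)) (coroot n i j) = 0" by simp
  then show False using ij coroot_cartan[OF ij(1,2)] by (simp add: eps_cartan coroot_def)
qed

lemma integral_weight_outside_cartan:
  "\<mu> \<in> integral_weights n \<Longrightarrow> X \<notin> cartan n \<Longrightarrow> \<mu> X = 0"
  by (auto simp: integral_weights_def fundamental_weight_def eps_def sum_fun_apply)

theorem corollary4p1:
  fixes r n :: nat and \<mu> :: weight
  assumes "r \<ge> 1" and "n = r + 1" and "\<mu> \<in> integral_weights n"
  shows "weight_mult n (highest_root n) \<mu> =
           (if \<mu> = 0 then r else if \<mu> \<in> sl_roots n then 1 else 0)"
proof -
  have mult: "weight_mult n (highest_root n) \<mu> =
      cfun.dim (sl_rep.weight_space cscale n (ad_space n) (ad_act n) \<mu>)"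
    using assms by (intro weight_mult_eq_dim is_L_ad) auto
  consider "\<mu> = 0" | "\<mu> \<in> sl_roots n" | "\<mu> \<noteq> 0" "\<mu> \<notin> sl_roots n" by blast
  then show ?thesis
  proof cases
    case 1
    then show ?thesis using mult dim_ad_zero_weight[of n] assms by simp
  next
    case 2
    then obtain i j where "i \<in> {1..n}" "j \<in> {1..n}" "i \<noteq> j" "\<mu> = eps n i - eps n j"
      by (auto simp: sl_roots_def)
    then have ij: "i - 1 < n" "j - 1 < n" "i - 1 \<noteq> j - 1"
      and \<mu>: "\<mu> = eps n (Suc (i - 1)) - eps n (Suc (j - 1))" by auto
    then show ?thesis using mult dim_ad_root[OF ij] root_nonzero[OF ij] 2 by simp
  next
    case 3
    have "cfun.dim {0} = 0" using cfun.dim_unique[of "{}" "{0}" 0] cfun.independent_empty by simp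
    then show ?thesis
      using 3 mult ad_weight_space_trivial[OF 3 integral_weight_outside_cartan[OF assms(3)]] by simp
  qed
qed

end
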